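(* Let $z$ be a single variable, $D=d/dz$, let $\Lambda(\xi)\in\mathbb{C}[\xi]$ be a non-zero polynomial in one variable $\xi$, and let $\Lambda=\Lambda(D)$. Let $P(z)\in\mathbb{C}[[z]]$ be a formal power series such that $\Lambda^m(P^m)=0$ for every $m\ge 1$. Then: (a) $P(z)$ is a polynomial in $z$. (b) For every polynomial $g(z)\in\mathbb{C}[z]$ there exists $N\ge 1$ such that $\Lambda^m(P^m g)=0$ for all $m\ge N$.
   Context: For a polynomial $\Lambda(\xi)=\sum_j c_j\xi^j\in\mathbb{C}[\xi]$, the differential operator $\Lambda(D)=\sum_j c_jD^j$ acts on $\mathbb{C}[[z]]$ in the usual (formal) way, and $\Lambda^m$ is its $m$-fold composition. $P^m$ is the $m$-th power of $P$ in the ring $\mathbb{C}[[z]]$. *)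

theory Defs
  imports Complex_Main "HOL-Computational_Algebra.Polynomial_FPS"
begin

definition poly_diff_op :: "complex poly \<Rightarrow> complex fps \<Rightarrow> complex fps" where
  "poly_diff_op \<Lambda> f = (\<Sum>j\<le>degree \<Lambda>. fps_const (coeff \<Lambda> j) * (fps_deriv ^^ j) f)"

end

theory Submission
  imports
    Defs
    "HOL-Computational_Algebra.Field_as_Ring"
    "HOL-Computational_Algebra.Polynomial_Factorial"
    "HOL-Computational_Algebra.Fundamental_Theorem_Algebra"
begin

text \<open>
  Since \<open>\<Lambda>(D)P = 0\<close>, the series \<open>P\<close> is a sum of generalised eigenvectors of \<open>D\<close>, and each
  eigenvalue is a root of \<open>\<Lambda>\<close>. Suppose some eigenvalue occurring in \<open>P\<close> is non-zero, and let \<open>\<mu>\<close>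
  be one of maximal modulus. All other eigenvalues \<open>x\<close> occurring in \<open>P\<close> satisfy
  \<open>Re (cnj \<mu> * x) < Re (cnj \<mu> * \<mu>)\<close>. Since eigenvalues add under multiplication, the component
  of \<open>P ^ m\<close> at \<open>m * \<mu>\<close> is the \<open>m\<close>-th power of the component of \<open>P\<close> at \<open>\<mu>\<close> and hence non-zero,
  so \<open>m * \<mu>\<close> is a root of \<open>\<Lambda>\<close> for every \<open>m \<ge> 1\<close>, which is impossible. Thus \<open>0\<close> is the only
  eigenvalue and \<open>P\<close> is a polynomial. On polynomials \<open>\<Lambda>(D)\<close> has the same kernel as \<open>D ^ k\<close>, where
  \<open>k\<close> is the order of \<open>\<Lambda>\<close> at \<open>0\<close>, so \<open>P = 0\<close> or \<open>degree P < k\<close>, and (b) follows by comparing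
  degrees. Writing series as exponential polynomials is avoided: generalised eigenspaces are
  described by annihilating polynomials and separated by Bezout's identity.
\<close>

section \<open>Algebra of constant-coefficient differential operators\<close>

text \<open>A free summation bound lets operators of different degrees share one range, as
  additivity in the polynomial requires: the degree of a sum may drop.\<close>

lemma poly_diff_op_altdef:
  assumes "degree p \<le> n"
  shows "poly_diff_op p f = (\<Sum>j\<le>n. fps_const (coeff p j) * (fps_deriv ^^ j) f)"
  unfolding poly_diff_op_def
  by (rule sum.mono_neutral_left) (use assms in \<open>auto intro: coeff_eq_0\<close>)

lemma poly_diff_op_0_left [simp]: "poly_diff_op 0 f = 0"
  by (simp add: poly_diff_op_def)

lemma poly_diff_op_1 [simp]: "poly_diff_op 1 f = f"
  by (simp add: poly_diff_op_def)

text \<open>A Horner-type recursion, on which most of the following inductions over polynomials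
  rest.\<close>

lemma poly_diff_op_pCons [simp]:
  "poly_diff_op (pCons a p) f = fps_const a * f + poly_diff_op p (fps_deriv f)"
proof -
  have "poly_diff_op (pCons a p) f
      = (\<Sum>j\<le>Suc (degree p). fps_const (coeff (pCons a p) j) * (fps_deriv ^^ j) f)"
    by (rule poly_diff_op_altdef) (simp add: degree_pCons_le)
  also have "\<dots> = fps_const a * f + poly_diff_op p (fps_deriv f)"
    by (subst sum.atMost_Suc_shift) (simp add: poly_diff_op_def funpow_swap1)
  finally show ?thesis .
qed

lemma poly_diff_op_0_right [simp]: "poly_diff_op p 0 = 0"
  by (induction p) auto

lemma poly_diff_op_add_right: "poly_diff_op p (f + g) = poly_diff_op p f + poly_diff_op p g"
  by (induction p arbitrary: f g) (auto simp: algebra_simps)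

lemma poly_diff_op_diff_right: "poly_diff_op p (f - g) = poly_diff_op p f - poly_diff_op p g"
  by (induction p arbitrary: f g) (auto simp: algebra_simps)

lemma poly_diff_op_smult: "poly_diff_op (smult c p) f = fps_const c * poly_diff_op p f"
  by (induction p arbitrary: f) (auto simp: algebra_simps simp flip: fps_const_mult)

lemma poly_diff_op_add: "poly_diff_op (p + q) f = poly_diff_op p f + poly_diff_op q f"
proof -
  define n where "n = max (degree p) (degree q)"
  have n: "degree p \<le> n" "degree q \<le> n" "degree (p + q) \<le> n"
    by (auto simp: n_def intro: degree_add_le)
  show ?thesis
    unfolding n[THEN poly_diff_op_altdef]
    by (simp add: algebra_simps sum.distrib flip: fps_const_add)
qed

lemma poly_diff_op_deriv: "poly_diff_op p (fps_deriv f) = fps_deriv (poly_diff_op p f)"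
  by (induction p arbitrary: f) auto

lemma poly_diff_op_mult: "poly_diff_op (p * q) f = poly_diff_op p (poly_diff_op q f)"
  by (induction p arbitrary: f)
     (auto simp: poly_diff_op_add poly_diff_op_smult poly_diff_op_deriv)

lemma poly_diff_op_power: "poly_diff_op (p ^ m) f = (poly_diff_op p ^^ m) f"
  by (induction m) (auto simp: poly_diff_op_mult)

lemma poly_diff_op_monom: "poly_diff_op (monom 1 k) f = (fps_deriv ^^ k) f"
  by (induction k arbitrary: f) (auto simp: monom_0 monom_Suc funpow_swap1)

section \<open>Coprime annihilators, and spectra of sums, products and powers\<close>

lemma bezout_no_common_root:
  fixes p q :: "complex poly"
  assumes "p \<noteq> 0" "\<And>x. poly p x = 0 \<Longrightarrow> poly q x \<noteq> 0"
  obtains u v where "u * p + v * q = 1"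
proof -
  have "coprime p q"
  proof (rule coprimeI)
    fix d assume d: "d dvd p" "d dvd q"
    have "d \<noteq> 0"
      using d assms(1) by auto
    \<comment> \<open>A non-constant common divisor would have a complex root, which
      \<open>p\<close> and \<open>q\<close> would share.\<close>
    moreover have "degree d = 0"
      using d assms(2) fundamental_theorem_of_algebra[of d]
      by (metis constant_degree dvd_trans poly_eq_0_iff_dvd)
    ultimately show "is_unit d"
      by (simp add: is_unit_iff_degree)
  qed
  hence "fst (bezout_coefficients p q) * p + snd (bezout_coefficients p q) * q = 1"
    by (simp add: bezout_coefficients_fst_snd)
  thus ?thesis using that by blast
qed

text \<open>Takes the place of the independence of generalised eigenspaces: in
  \<open>u * p + v * q = 1\<close> both summands kill \<open>f\<close>, while the right-hand side
  fixes it.\<close>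

lemma poly_diff_op_no_common_root:
  assumes "p \<noteq> 0" "\<And>x. poly p x = 0 \<Longrightarrow> poly q x \<noteq> 0"
    and "poly_diff_op p f = 0" "poly_diff_op q f = 0"
  shows "f = 0"
proof -
  obtain u v where "u * p + v * q = 1"
    using bezout_no_common_root[of p q] assms(1,2) by blast
  hence "f = poly_diff_op (u * p + v * q) f"
    by simp
  also have "\<dots> = 0"
    by (simp add: poly_diff_op_add poly_diff_op_mult assms)
  finally show ?thesis .
qed

text \<open>In terms of exponential polynomials: \<open>f\<close> is a finite sum of terms \<open>h(z) exp(xz)\<close> with
  polynomials \<open>h\<close> and \<open>x \<in> S\<close>.\<close>

definition spectrum_in :: "complex set \<Rightarrow> complex fps \<Rightarrow> bool" where
  "spectrum_in S f \<longleftrightarrow> (\<exists>q. q \<noteq> 0 \<and> (\<forall>x. poly q x = 0 \<longrightarrow> x \<in> S) \<and> poly_diff_op q f = 0)"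

lemma spectrum_inI:
  assumes "q \<noteq> 0" "\<And>x. poly q x = 0 \<Longrightarrow> x \<in> S" "poly_diff_op q f = 0"
  shows "spectrum_in S f"
  using assms unfolding spectrum_in_def by blast

lemma spectrum_in_mono: "spectrum_in S f \<Longrightarrow> S \<subseteq> T \<Longrightarrow> spectrum_in T f"
  unfolding spectrum_in_def by blast

lemma spectrum_in_0 [simp]: "spectrum_in S 0"
  by (rule spectrum_inI[of 1]) auto

lemma spectrum_in_1: "0 \<in> S \<Longrightarrow> spectrum_in S 1"
  by (rule spectrum_inI[of "[:0, 1:]"]) auto

lemma spectrum_in_add:
  assumes "spectrum_in S f" "spectrum_in S g"
  shows "spectrum_in S (f + g)"
proof -
  obtain p where p: "p \<noteq> 0" "\<And>x. poly p x = 0 \<Longrightarrow> x \<in> S" "poly_diff_op p f = 0"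
    using assms(1) unfolding spectrum_in_def by blast
  obtain q where q: "q \<noteq> 0" "\<And>x. poly q x = 0 \<Longrightarrow> x \<in> S" "poly_diff_op q g = 0"
    using assms(2) unfolding spectrum_in_def by blast
  have "poly_diff_op (p * q) f = 0"
    by (subst mult.commute) (simp add: poly_diff_op_mult p)
  thus ?thesis
    using p q by (intro spectrum_inI[of "p * q"]) (auto simp: poly_diff_op_add_right poly_diff_op_mult)
qed

lemma spectrum_in_linear_factor:
  assumes "spectrum_in S (poly_diff_op [:-a, 1:] f)" "a \<in> S"
  shows "spectrum_in S f"
proof -
  obtain q where q: "q \<noteq> 0" "\<And>x. poly q x = 0 \<Longrightarrow> x \<in> S"
      "poly_diff_op q (poly_diff_op [:-a, 1:] f) = 0"
    using assms(1) unfolding spectrum_in_def by blast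
  show ?thesis
  proof (rule spectrum_inI)
    show "poly_diff_op (q * [:-a, 1:]) f = 0"
      by (simp only: poly_diff_op_mult q(3))
    show "q * [:-a, 1:] \<noteq> 0"
      using q(1) by (simp del: mult_pCons_right)
  qed (use q(2) assms(2) in auto)
qed

text \<open>By the Leibniz rule, \<open>D - (a + b)\<close> maps \<open>f * g\<close> to
  \<open>((D - a) f) * g + f * ((D - b) g)\<close>. For roots \<open>a\<close> of \<open>p\<close>
  and \<open>b\<close> of \<open>q\<close>, each summand has a factor with an annihilator of smaller
  degree. The annihilators are explicit because the induction runs over the sum of their
  degrees.\<close>

lemma spectrum_in_mult_aux:
  assumes "p \<noteq> 0" "\<And>x. poly p x = 0 \<Longrightarrow> x \<in> S" "poly_diff_op p f = 0"
    and "q \<noteq> 0" "\<And>x. poly q x = 0 \<Longrightarrow> x \<in> T" "poly_diff_op q g = 0"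
    and "\<And>x y. x \<in> S \<Longrightarrow> y \<in> T \<Longrightarrow> x + y \<in> U"
  shows "spectrum_in U (f * g)"
  using assms(1-6)
proof (induction "degree p + degree q" arbitrary: p q f g rule: less_induct)
  case less
  note prems = less.prems
  show ?case
  proof (cases "degree p = 0 \<or> degree q = 0")
    case True
    \<comment> \<open>A non-zero constant annihilates only the zero series.\<close>
    hence "f = 0 \<or> g = 0"
      using prems by (auto elim!: degree_eq_zeroE)
    thus ?thesis by auto
  next
    case False
    obtain a where a: "poly p a = 0"
      using False fundamental_theorem_of_algebra[of p] by (auto simp: constant_degree)
    obtain b where b: "poly q b = 0"
      using False fundamental_theorem_of_algebra[of q] by (auto simp: constant_degree)
    obtain p' where p': "p = p' * [:-a, 1:]"
      using a by (auto simp: poly_eq_0_iff_dvd mult.commute elim: dvdE)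
    obtain q' where q': "q = q' * [:-b, 1:]"
      using b by (auto simp: poly_eq_0_iff_dvd mult.commute elim: dvdE)
    have nz: "p' \<noteq> 0" "q' \<noteq> 0"
      using prems p' q' by auto
    have deg: "degree p = Suc (degree p')" "degree q = Suc (degree q')"
      using nz by (simp_all add: p' q' degree_mult_eq del: mult_pCons_right)
    have "spectrum_in U (poly_diff_op [:-a, 1:] f * g)"
      using nz deg prems
      by (intro less.hyps[of p' q]) (auto simp: p' poly_diff_op_mult
            simp del: mult_pCons_right poly_diff_op_pCons)
    moreover have "spectrum_in U (f * poly_diff_op [:-b, 1:] g)"
      using nz deg prems
      by (intro less.hyps[of p q']) (auto simp: q' poly_diff_op_mult
            simp del: mult_pCons_right poly_diff_op_pCons)
    ultimately have "spectrum_in U (poly_diff_op [:-a, 1:] f * g + f * poly_diff_op [:-b, 1:] g)"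
      by (rule spectrum_in_add)
    also have "poly_diff_op [:-a, 1:] f * g + f * poly_diff_op [:-b, 1:] g
        = poly_diff_op [:-(a + b), 1:] (f * g)"
      by (simp add: algebra_simps flip: fps_const_add fps_const_neg fps_const_sub)
    finally show ?thesis
      by (rule spectrum_in_linear_factor) (use a b prems assms(7) in auto)
  qed
qed

lemma spectrum_in_mult:
  assumes "spectrum_in S f" "spectrum_in T g" "\<And>x y. x \<in> S \<Longrightarrow> y \<in> T \<Longrightarrow> x + y \<in> U"
  shows "spectrum_in U (f * g)"
  using assms(1,2) spectrum_in_mult_aux[of _ S f _ T g U, OF _ _ _ _ _ _ assms(3)]
  unfolding spectrum_in_def by blast

lemma spectrum_in_power:
  assumes "spectrum_in {\<mu>} f"
  shows "spectrum_in {of_nat m * \<mu>} (f ^ m)"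
proof (induction m)
  case (Suc m)
  show ?case
    unfolding power_Suc
    by (rule spectrum_in_mult[OF assms Suc.IH]) (auto simp: algebra_simps)
qed (auto intro: spectrum_in_1)

text \<open>The functional \<open>Re (cnj \<mu> * x)\<close> is additive in \<open>x\<close>, and
  \<open>(f + h) ^ Suc m - f ^ Suc m = (f + h) * ((f + h) ^ m - f ^ m) + f ^ m * h\<close>. Each
  summand has one factor strictly below its bound.\<close>

lemma spectrum_in_power_diff:
  assumes f: "spectrum_in {\<mu>} f" and h: "spectrum_in {x. Re (cnj \<mu> * x) < Re (cnj \<mu> * \<mu>)} h"
  shows "spectrum_in {x. Re (cnj \<mu> * x) < of_nat m * Re (cnj \<mu> * \<mu>)} ((f + h) ^ m - f ^ m)"
proof (induction m)
  case (Suc m)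
  define R where "R = Re (cnj \<mu> * \<mu>)"
  define L where "L x = Re (cnj \<mu> * x)" for x
  have L_add: "L (x + y) = L x + L y" for x y
    by (simp add: L_def algebra_simps)
  have L_mult: "L (of_nat m * \<mu>) = of_nat m * R"
    by (simp add: L_def R_def algebra_simps)
  note f = f and h = h[folded R_def, folded L_def] and IH = Suc.IH[folded R_def, folded L_def]
  \<comment> \<open>For \<open>f + h\<close> only the weak bound holds, since \<open>\<mu>\<close>
    attains \<open>R\<close>; strictness of the product comes from the induction hypothesis.\<close>
  have "spectrum_in {x. L x \<le> R} f" "spectrum_in {x. L x \<le> R} h"
    by (rule spectrum_in_mono[OF f] spectrum_in_mono[OF h]; auto simp: L_def R_def)+
  hence "spectrum_in {x. L x \<le> R} (f + h)"
    by (rule spectrum_in_add)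
  hence "spectrum_in {x. L x < of_nat (Suc m) * R} ((f + h) * ((f + h) ^ m - f ^ m))"
    by (rule spectrum_in_mult[OF _ IH]) (auto simp: L_add algebra_simps)
  moreover have "spectrum_in {x. L x < of_nat (Suc m) * R} (f ^ m * h)"
    by (rule spectrum_in_mult[OF spectrum_in_power[OF f] h]) (auto simp: L_add L_mult distrib_right)
  ultimately have "spectrum_in {x. L x < of_nat (Suc m) * R}
      ((f + h) * ((f + h) ^ m - f ^ m) + f ^ m * h)"
    by (rule spectrum_in_add)
  thus ?case
    by (simp add: algebra_simps L_def R_def)
qed auto

section \<open>The extremal eigenvalue and its multiples\<close>

lemma Re_cnj_mult_less:
  assumes "norm x \<le> norm \<mu>" "x \<noteq> \<mu>"
  shows "Re (cnj \<mu> * x) < Re (cnj \<mu> * \<mu>)"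
proof -
  \<comment> \<open>Expanding this square bounds \<open>2 * Re (cnj \<mu> * x)\<close> strictly by
    the sum of the squared norms of \<open>x\<close> and \<open>\<mu>\<close>.\<close>
  have "0 < (norm (x - \<mu>))\<^sup>2"
    using assms by simp
  moreover have "(norm (x - \<mu>))\<^sup>2 = (norm x)\<^sup>2 + (norm \<mu>)\<^sup>2 - 2 * Re (cnj \<mu> * x)"
    unfolding cmod_power2 by (simp add: power2_eq_square algebra_simps)
  moreover have "(norm x)\<^sup>2 \<le> (norm \<mu>)\<^sup>2"
    using assms by (intro power_mono) auto
  moreover have "Re (cnj \<mu> * \<mu>) = (norm \<mu>)\<^sup>2"
    unfolding cmod_power2 by (simp add: power2_eq_square)
  ultimately show ?thesis by linarith
qed

text \<open>Otherwise \<open>f ^ m\<close> is killed by \<open>s\<close>, whose only possible root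
  is \<open>of_nat m * \<mu>\<close>, and by \<open>r * q\<close>, which does not vanish
  there.\<close>

lemma multiple_is_root:
  assumes "spectrum_in {\<mu>} f" "spectrum_in {x. Re (cnj \<mu> * x) < Re (cnj \<mu> * \<mu>)} h" "f \<noteq> 0"
    and "poly_diff_op q ((f + h) ^ m) = 0"
  shows "poly q (of_nat m * \<mu>) = 0"
proof (rule ccontr)
  assume nz: "poly q (of_nat m * \<mu>) \<noteq> 0"
  obtain s where s: "s \<noteq> 0" "\<And>x. poly s x = 0 \<Longrightarrow> x = of_nat m * \<mu>" "poly_diff_op s (f ^ m) = 0"
    using spectrum_in_power[OF assms(1), of m] unfolding spectrum_in_def by auto
  obtain r where r: "r \<noteq> 0" "\<And>x. poly r x = 0 \<Longrightarrow> Re (cnj \<mu> * x) < of_nat m * Re (cnj \<mu> * \<mu>)"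
      "poly_diff_op r ((f + h) ^ m - f ^ m) = 0"
    using spectrum_in_power_diff[OF assms(1,2), of m] unfolding spectrum_in_def by auto
  have "f ^ m = 0"
  proof (rule poly_diff_op_no_common_root[of s "r * q"])
    have "poly_diff_op (r * q) ((f + h) ^ m) = 0"
      by (simp add: poly_diff_op_mult assms(4))
    moreover have "poly_diff_op (r * q) ((f + h) ^ m - f ^ m) = 0"
      by (subst mult.commute) (simp add: poly_diff_op_mult r(3))
    ultimately show "poly_diff_op (r * q) (f ^ m) = 0"
      by (simp add: poly_diff_op_diff_right)
    fix x assume "poly s x = 0"
    hence x: "x = of_nat m * \<mu>"
      by (rule s(2))
    \<comment> \<open>Equality at the boundary, whereas all roots of \<open>r\<close> lie strictly
      below it.\<close>
    have "Re (cnj \<mu> * x) = of_nat m * Re (cnj \<mu> * \<mu>)"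
      by (simp add: x algebra_simps)
    hence "poly r x \<noteq> 0"
      using r(2)[of x] by auto
    thus "poly (r * q) x \<noteq> 0"
      using nz x by simp
  qed (use s in auto)
  thus False
    using assms(3) by simp
qed

lemma not_all_multiples_roots:
  fixes q :: "complex poly"
  assumes "q \<noteq> 0" "\<mu> \<noteq> 0"
  obtains m where "m \<ge> 1" "poly q (of_nat m * \<mu>) \<noteq> 0"
proof -
  have "inj_on (\<lambda>m. of_nat m * \<mu>) {1::nat..}"
    using assms(2) by (auto simp: inj_on_def)
  hence "infinite ((\<lambda>m. of_nat m * \<mu>) ` {1::nat..})"
    by (simp add: finite_image_iff infinite_Ici)
  hence "\<not> (\<lambda>m. of_nat m * \<mu>) ` {1::nat..} \<subseteq> {x. poly q x = 0}"
    using poly_roots_finite[OF assms(1)] finite_subset by blast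
  thus ?thesis using that by auto
qed

text \<open>An annihilator \<open>p\<close> of \<open>f\<close> is split as \<open>s * p'\<close>,
  where \<open>s\<close> carries the full multiplicity of a root \<open>\<mu>\<close> of largest
  modulus; \<open>f1\<close> and \<open>f2\<close> are the matching Bezout projections of
  \<open>f\<close>.\<close>

lemma exists_extremal_decomposition:
  assumes "q \<noteq> 0" "poly_diff_op q f = 0" and "\<not> spectrum_in {0} f"
  obtains \<mu> f1 f2 where "\<mu> \<noteq> 0" "f = f1 + f2" "f1 \<noteq> 0" "spectrum_in {\<mu>} f1"
    "spectrum_in {x. Re (cnj \<mu> * x) < Re (cnj \<mu> * \<mu>)} f2"
proof -
  \<comment> \<open>Minimality of the degree ensures that every root of \<open>p\<close> really
    occurs in \<open>f\<close>; this gives \<open>f1 \<noteq> 0\<close> below.\<close>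
  define A where "A = (\<lambda>p. p \<noteq> 0 \<and> poly_diff_op p f = 0)"
  define p where "p = arg_min degree A"
  have p: "p \<noteq> 0" "poly_diff_op p f = 0"
    using arg_min_natI[of A q degree] assms by (auto simp: A_def p_def)
  have p_min: "degree p \<le> degree r" if "r \<noteq> 0" "poly_diff_op r f = 0" for r
    using arg_min_nat_le[of A r degree] that by (auto simp: A_def p_def)
  define Z where "Z = {x. poly p x = 0}"
  \<comment> \<open>If \<open>p\<close> had no root besides \<open>0\<close>, it would itself
    witness \<open>spectrum_in {0} f\<close>.\<close>
  obtain x0 where x0: "x0 \<in> Z" "x0 \<noteq> 0"
    using assms(3) p spectrum_inI[of p "{0}" f] by (auto simp: Z_def)
  have "finite Z"
    using p by (auto simp: Z_def poly_roots_finite)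
  define M where "M = Max (norm ` Z)"
  have "M \<in> norm ` Z"
    unfolding M_def using \<open>finite Z\<close> x0 by (intro Max_in) auto
  then obtain \<mu> where \<mu>: "\<mu> \<in> Z" "norm \<mu> = M"
    by auto
  have max: "norm x \<le> norm \<mu>" if "x \<in> Z" for x
    using that \<open>finite Z\<close> by (simp add: \<mu>(2) M_def)
  have "\<mu> \<noteq> 0"
    using max[OF x0(1)] x0(2) by auto
  obtain p' where p': "p = [:-\<mu>, 1:] ^ order \<mu> p * p'" "\<not> [:-\<mu>, 1:] dvd p'"
    using order_decomp[OF p(1), of \<mu>] by blast
  define s where "s = [:-\<mu>, 1:] ^ order \<mu> p"
  have ps: "p = s * p'"
    using p'(1) by (simp add: s_def)
  have s: "x = \<mu>" if "poly s x = 0" for x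
    using that by (simp add: s_def)
  have "s \<noteq> 0" "p' \<noteq> 0"
    using p(1) ps by auto
  have p'_root: "poly p' \<mu> \<noteq> 0"
    using p'(2) by (simp add: poly_eq_0_iff_dvd)
  obtain u v where uv: "u * s + v * p' = 1"
    using bezout_no_common_root[of s p'] \<open>s \<noteq> 0\<close> s p'_root by blast
  define f1 where "f1 = poly_diff_op (v * p') f"
  define f2 where "f2 = poly_diff_op (u * s) f"
  have "f = f1 + f2"
    unfolding f1_def f2_def poly_diff_op_add[symmetric]
    by (subst add.commute) (simp add: uv)
  moreover have f1: "poly_diff_op s f1 = 0"
  proof -
    have "poly_diff_op s f1 = poly_diff_op (v * p) f"
      unfolding f1_def poly_diff_op_mult[symmetric] ps by (simp add: mult_ac)
    thus ?thesis
      by (simp add: poly_diff_op_mult p)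
  qed
  moreover have f2: "poly_diff_op p' f2 = 0"
  proof -
    have "poly_diff_op p' f2 = poly_diff_op (u * p) f"
      unfolding f2_def poly_diff_op_mult[symmetric] ps by (simp add: mult_ac)
    thus ?thesis
      by (simp add: poly_diff_op_mult p)
  qed
  moreover have "f1 \<noteq> 0"
  proof
    \<comment> \<open>Then \<open>f = f2\<close>, so \<open>p'\<close> already annihilates
      \<open>f\<close>, although it has smaller degree than \<open>p\<close>.\<close>
    assume "f1 = 0"
    hence "poly_diff_op p' f = 0"
      using f2 \<open>f = f1 + f2\<close> by simp
    hence "degree p \<le> degree p'"
      using p_min \<open>p' \<noteq> 0\<close> by blast
    hence "degree s = 0"
      using \<open>s \<noteq> 0\<close> \<open>p' \<noteq> 0\<close> by (simp add: ps degree_mult_eq)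
    hence "order \<mu> p = 0"
      by (simp add: s_def degree_power_eq)
    thus False
      using \<mu>(1) p(1) by (simp add: Z_def order_root)
  qed
  moreover have "spectrum_in {\<mu>} f1"
    using \<open>s \<noteq> 0\<close> s f1 by (intro spectrum_inI[of s]) auto
  moreover have "spectrum_in {x. Re (cnj \<mu> * x) < Re (cnj \<mu> * \<mu>)} f2"
  proof (rule spectrum_inI)
    fix x assume x: "poly p' x = 0"
    hence "x \<in> Z"
      by (simp add: Z_def ps)
    thus "x \<in> {x. Re (cnj \<mu> * x) < Re (cnj \<mu> * \<mu>)}"
      using Re_cnj_mult_less[OF max] x p'_root by blast
  qed (use \<open>p' \<noteq> 0\<close> f2 in auto)
  ultimately show ?thesis
    using that \<open>\<mu> \<noteq> 0\<close> by blast
qed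

section \<open>The eigenvalue zero: polynomials and powers of \<open>D\<close>\<close>

lemma fps_deriv_funpow_eq_0_iff:
  fixes f :: "complex fps"
  shows "(fps_deriv ^^ k) f = 0 \<longleftrightarrow> (\<forall>n\<ge>k. fps_nth f n = 0)"
proof (induction k arbitrary: f)
  case (Suc k)
  have "(fps_deriv ^^ Suc k) f = 0 \<longleftrightarrow> (\<forall>n\<ge>k. fps_nth (fps_deriv f) n = 0)"
    using Suc.IH[of "fps_deriv f"] by (simp only: funpow_Suc_right o_apply)
  also have "\<dots> \<longleftrightarrow> (\<forall>n\<ge>k. fps_nth f (Suc n) = 0)"
    by (simp add: add_eq_0_iff del: of_nat_Suc)
  also have "\<dots> \<longleftrightarrow> (\<forall>n\<ge>Suc k. fps_nth f n = 0)"
    by (metis Suc_le_D Suc_le_mono)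
  finally show ?case .
qed (auto simp: fps_eq_iff)

lemma fps_deriv_funpow_fps_of_poly:
  assumes "degree p < k"
  shows "(fps_deriv ^^ k) (fps_of_poly p :: complex fps) = 0"
  using assms by (auto simp: fps_deriv_funpow_eq_0_iff coeff_eq_0)

text \<open>Write \<open>q = q' * X\<close> with \<open>X\<close> the full power of the variable
  dividing \<open>q\<close>. Then \<open>X\<close> applied to \<open>f\<close> is killed by
  \<open>q'\<close>, which is non-zero at \<open>0\<close>, and by \<open>r\<close>, which has no
  other root than \<open>0\<close>.\<close>

lemma spectrum_in_0_kernel:
  assumes "spectrum_in {0} f" "q \<noteq> 0" "poly_diff_op q f = 0"
  shows "(fps_deriv ^^ order 0 q) f = 0"
proof -
  obtain r where r: "r \<noteq> 0" "\<And>x. poly r x = 0 \<Longrightarrow> x = 0" "poly_diff_op r f = 0"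
    using assms(1) unfolding spectrum_in_def by auto
  define X where "X = monom (1::complex) (order 0 q)"
  obtain q' where q': "q = [:0, 1:] ^ order 0 q * q'" "\<not> [:0, 1:] dvd q'"
    using order_decomp[OF assms(2), of 0] by auto
  have qX: "q = q' * X"
    by (subst q'(1)) (simp add: X_def monom_altdef)
  have "poly q' 0 \<noteq> 0"
    using q'(2) by (simp add: poly_eq_0_iff_dvd)
  have "poly_diff_op X f = 0"
  proof (rule poly_diff_op_no_common_root)
    show "r \<noteq> 0" by fact
    show "poly q' x \<noteq> 0" if "poly r x = 0" for x
      using \<open>poly q' 0 \<noteq> 0\<close> r(2)[OF that] by simp
    show "poly_diff_op q' (poly_diff_op X f) = 0"
      using assms(3) by (simp add: qX poly_diff_op_mult)
    have "poly_diff_op (X * r) f = 0"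
      by (simp add: poly_diff_op_mult r(3))
    thus "poly_diff_op r (poly_diff_op X f) = 0"
      by (subst (asm) mult.commute) (simp add: poly_diff_op_mult)
  qed
  thus ?thesis
    by (simp add: X_def poly_diff_op_monom)
qed

lemma spectrum_in_0_imp_poly:
  assumes "spectrum_in {0} f"
  obtains p where "f = fps_of_poly p"
proof -
  obtain q where "q \<noteq> 0" "poly_diff_op q f = 0"
    using assms unfolding spectrum_in_def by auto
  hence "(fps_deriv ^^ order 0 q) f = 0"
    by (rule spectrum_in_0_kernel[OF assms])
  hence "\<forall>\<^sub>\<infinity>n. fps_nth f n = 0"
    by (auto simp: fps_deriv_funpow_eq_0_iff MOST_nat_le)
  hence "coeff (Abs_poly (fps_nth f)) = fps_nth f"
    by (intro coeff_Abs_poly_If_le Abs_poly_inverse) auto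
  hence "f = fps_of_poly (Abs_poly (fps_nth f))"
    by (simp add: fps_eq_iff)
  thus ?thesis using that by blast
qed

lemma poly_diff_op_monom_dvd:
  assumes "(fps_deriv ^^ k) f = 0" "monom 1 k dvd q"
  shows "poly_diff_op q f = 0"
proof -
  obtain r where "q = r * monom 1 k"
    using assms(2) by (auto simp: mult.commute)
  thus ?thesis
    by (simp add: poly_diff_op_mult poly_diff_op_monom assms(1))
qed

theorem theorem2p3:
  fixes \<Lambda> :: "complex poly" and P :: "complex fps"
  assumes "\<Lambda> \<noteq> 0"
    and "\<And>m. m \<ge> 1 \<Longrightarrow> (poly_diff_op \<Lambda> ^^ m) (P ^ m) = 0"
  shows "(\<exists>p :: complex poly. P = fps_of_poly p) \<and>
    (\<forall>g :: complex poly. \<exists>N\<ge>1. \<forall>m\<ge>N. (poly_diff_op \<Lambda> ^^ m) (P ^ m * fps_of_poly g) = 0)"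
proof -
  have \<Lambda>P: "poly_diff_op \<Lambda> P = 0"
    using assms(2)[of 1] by simp
  have spec: "spectrum_in {0} P"
  proof (rule ccontr)
    assume "\<not> spectrum_in {0} P"
    then obtain \<mu> f h where *: "\<mu> \<noteq> 0" "P = f + h" "f \<noteq> 0" "spectrum_in {\<mu>} f"
        "spectrum_in {x. Re (cnj \<mu> * x) < Re (cnj \<mu> * \<mu>)} h"
      using exists_extremal_decomposition[OF assms(1) \<Lambda>P] by blast
    obtain m where m: "m \<ge> 1" "poly \<Lambda> (of_nat m * \<mu>) \<noteq> 0"
      using not_all_multiples_roots[OF assms(1) *(1)] by blast
    \<comment> \<open>The annihilator of the \<open>m\<close>-th power is
      \<open>\<Lambda> ^ m\<close>, which has the same roots as \<open>\<Lambda>\<close>.\<close>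
    have "poly_diff_op (\<Lambda> ^ m) ((f + h) ^ m) = 0"
      using assms(2)[OF m(1)] by (simp add: poly_diff_op_power *(2))
    hence "poly (\<Lambda> ^ m) (of_nat m * \<mu>) = 0"
      by (rule multiple_is_root[OF *(4,5,3)])
    thus False
      using m(2) by simp
  qed
  then obtain p where p: "P = fps_of_poly p"
    by (rule spectrum_in_0_imp_poly)
  define k where "k = order 0 \<Lambda>"
  have "monom 1 k dvd \<Lambda>"
    using order_1[of 0 \<Lambda>] by (simp add: k_def monom_altdef)
  have coeff_0: "coeff p n = 0" if "n \<ge> k" for n
    using spectrum_in_0_kernel[OF spec assms(1) \<Lambda>P] that
    by (simp add: k_def p fps_deriv_funpow_eq_0_iff)
  have "(poly_diff_op \<Lambda> ^^ m) (P ^ m * fps_of_poly g) = 0" if m: "m \<ge> Suc (degree g)" for m g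
  proof (cases "p = 0")
    \<comment> \<open>Treated apart because \<open>degree 0 = 0\<close> is not below
      \<open>k\<close> when \<open>k = 0\<close>. Here \<open>m \<ge> 1\<close> makes
      \<open>P ^ m\<close> vanish.\<close>
    case True
    thus ?thesis
      using m by (simp add: p power_0_left flip: poly_diff_op_power)
  next
    case False
    have deg: "degree p < k"
      using coeff_0 False leading_coeff_neq_0 not_le by blast
    \<comment> \<open>Each factor of \<open>\<Lambda>\<close> lowers the degree by at least
      \<open>k\<close>, and each factor \<open>p\<close> raises it by at most \<open>k - 1\<close>;
      so \<open>m > degree g\<close> applications exhaust \<open>g\<close> as well.\<close>
    have "degree (p ^ m * g) \<le> m * degree p + degree g"
      using degree_mult_le[of "p ^ m" g] degree_power_le[of p m] by (simp add: mult.commute)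
    also have "\<dots> < m * degree p + m"
      using m by simp
    also have "\<dots> \<le> k * m"
      using deg mult_le_mono2[of "Suc (degree p)" k m] by (simp add: mult.commute)
    finally have "(fps_deriv ^^ (k * m)) (fps_of_poly (p ^ m * g) :: complex fps) = 0"
      by (rule fps_deriv_funpow_fps_of_poly)
    moreover have "monom 1 (k * m) dvd \<Lambda> ^ m"
      using dvd_power_same[OF \<open>monom 1 k dvd \<Lambda>\<close>, of m] by (simp add: monom_power)
    ultimately have "poly_diff_op (\<Lambda> ^ m) (fps_of_poly (p ^ m * g)) = 0"
      by (rule poly_diff_op_monom_dvd)
    thus ?thesis
      by (simp add: p poly_diff_op_power fps_of_poly_mult fps_of_poly_power)
  qed
  hence "\<exists>N\<ge>1. \<forall>m\<ge>N. (poly_diff_op \<Lambda> ^^ m) (P ^ m * fps_of_poly g) = 0" for g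
    by (intro exI[of _ "Suc (degree g)"]) auto
  with p show ?thesis
    by blast
qed

end
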